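(* Let $A$ be a semisimple complex Banach algebra with identity. Then the set of commutators $$\mathcal{C}=\{\,xy-yx : x,y\in\mathrm{Soc}\,A\,\}$$ is a vector subspace of $\mathrm{Soc}\,A$.
   Context: $\mathrm{Soc}\,A$ is the socle of $A$, the sum of all minimal left ideals of $A$ ($\{0\}$ if there are none). For semisimple $A$ it is a two-sided ideal and coincides with the set of finite-rank elements, i.e. those $a\in A$ with $\mathrm{rank}(a)=\sup_{x\in A}\#(\sigma(xa)\setminus\{0\})<\infty$, $\sigma$ denoting the spectrum. *)

theory Defs
  imports Complex_Main
begin

text \<open>
  A complex Banach algebra with identity: the complex scalar multiplication is an explicit
  parameter extending the real one of the type. The sort deliberately
  avoids \<open>real_normed_algebra_1\<close>, so neither \<open>norm 1 = 1\<close> nor \<open>1 \<noteq> 0\<close> is required.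
\<close>

locale complex_banach_algebra = vector_space scale
  for scale :: "complex \<Rightarrow> 'a::{banach, real_normed_algebra, monoid_mult} \<Rightarrow> 'a"
    (infixr \<open>*s\<close> 75) +
  assumes scale_of_real: "of_real r *s x = r *\<^sub>R x"
    and norm_scale: "norm (c *s x) = cmod c * norm x"
    and scale_mult_left: "(c *s x) * y = c *s (x * y)"
    and scale_mult_right: "x * (c *s y) = c *s (x * y)"
begin

definition left_ideal :: "'a set \<Rightarrow> bool" where
  "left_ideal L \<longleftrightarrow> subspace L \<and> (\<forall>a. \<forall>x\<in>L. a * x \<in> L)"

definition minimal_left_ideal :: "'a set \<Rightarrow> bool" where
  "minimal_left_ideal L \<longleftrightarrow> left_ideal L \<and> L \<noteq> {0} \<and>
     (\<forall>J. left_ideal J \<and> J \<subseteq> L \<longrightarrow> J = {0} \<or> J = L)"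

definition maximal_left_ideal :: "'a set \<Rightarrow> bool" where
  "maximal_left_ideal L \<longleftrightarrow> left_ideal L \<and> L \<noteq> UNIV \<and>
     (\<forall>J. left_ideal J \<and> L \<subseteq> J \<longrightarrow> J = L \<or> J = UNIV)"

definition radical :: "'a set" where
  "radical = \<Inter> {L. maximal_left_ideal L}"

definition semisimple :: bool where
  "semisimple \<longleftrightarrow> radical = {0}"

text \<open>The sum of a family of subspaces is the span of its union; it is \<open>{0}\<close> for the empty family.\<close>

definition socle :: "'a set" where
  "socle = span (\<Union> {L. minimal_left_ideal L})"

end

end

(*
  Gelfand-Mazur makes every minimal left ideal of the form A e with e a minimal idempotent,
  e A e = C e. Finitely many elements of the socle lie in a common corner e A e, where e is a sum
  of finitely many pairwise orthogonal minimal idempotents; this corner is a product of matrix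
  algebras, with one block for each class of idempotents f, g linked by f A g \<noteq> 0. A sum t
  of commutators has trace zero in every block. As in Shoda's theorem, 2 x 2 moves change the
  orthogonal family into one with f t f = 0 for all its members f, and then t is the commutator of
  a diagonal element with distinct entries l f and the element with entries
  f t g / (l f - l g), both of which lie in the socle.
*)

theory Submission
  imports Defs "HOL-Analysis.Henstock_Kurzweil_Integration"
begin

no_notation vector_scalar_mult (infixl \<open>*s\<close> 70)

context complex_banach_algebra
begin

lemmas scale_mult = scale_mult_left scale_mult_right

section \<open>Liouville's theorem and the Gelfand-Mazur theorem in a corner\<close>

lemma bounded_bilinear_scale: "bounded_bilinear scale"
proof
  show "(r *\<^sub>R c) *s x = r *\<^sub>R (c *s x)" for r c x
    by (metis scaleR_conv_of_real scale_of_real scale_scale)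
  show "c *s (r *\<^sub>R x) = r *\<^sub>R (c *s x)" for r c x
    by (metis scale_left_commute scale_of_real)
  show "\<exists>K. \<forall>c x. norm (c *s x) \<le> norm c * norm x * K"
    by (rule exI[of _ 1]) (simp add: norm_scale)
qed (simp_all add: scale_left_distrib scale_right_distrib)

text \<open>The integral of \<open>f\<close> over the circle of radius \<open>r\<close> does not depend on \<open>r\<close>, because its
  \<open>r\<close>-derivative is the integral of a \<open>\<theta>\<close>-derivative. This avoids the functionals of the
  Hahn--Banach theorem.\<close>

lemma Liouville_vector_valued:
  assumes deriv: "\<And>z. (f has_derivative (\<lambda>h. h *s g z)) (at z)"
    and cont: "continuous_on UNIV g"
    and lim: "(f \<longlongrightarrow> 0) at_infinity"
  shows "f 0 = 0"
proof -
  interpret sc: bounded_bilinear scale by (rule bounded_bilinear_scale)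
  let ?F = "\<lambda>r. integral (cbox 0 (2*pi)) (\<lambda>\<theta>. f (of_real r * cis \<theta>))"
  have contf: "continuous_on UNIV f"
    using deriv by (meson continuous_at_imp_continuous_on has_derivative_continuous)
  have vderiv: "((\<lambda>t. f (\<gamma> t)) has_vector_derivative (d *s g (\<gamma> t))) (at t within U)"
    if "(\<gamma> has_vector_derivative d) (at t within U)" for \<gamma> d t U
  proof -
    have "((\<lambda>t. f (\<gamma> t)) has_derivative (\<lambda>h. (h *\<^sub>R d) *s g (\<gamma> t))) (at t within U)"
      by (rule has_derivative_in_compose[OF that[unfolded has_vector_derivative_def]
            has_derivative_at_withinI[OF deriv]])
    then show ?thesis by (simp add: has_vector_derivative_def sc.scaleR_left)
  qed
  have contc: "continuous_on UNIV (\<lambda>\<theta>. f (of_real r * cis \<theta>))" for r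
    by (intro continuous_on_compose2[OF contf] continuous_intros) auto
  have D: "(?F has_vector_derivative 0) (at r)" for r
  proof -
    have "(?F has_vector_derivative
        integral (cbox 0 (2*pi)) (\<lambda>\<theta>. cis \<theta> *s g (of_real r * cis \<theta>))) (at r within UNIV)"
    proof (rule leibniz_rule_vector_derivative)
      show "((\<lambda>r. f (of_real r * cis \<theta>)) has_vector_derivative
          cis \<theta> *s g (of_real r * cis \<theta>)) (at r within UNIV)" for r \<theta>
        by (rule vderiv) (auto intro!: derivative_eq_intros simp: has_vector_derivative_def scaleR_conv_of_real)
      show "(\<lambda>\<theta>. f (of_real r * cis \<theta>)) integrable_on cbox 0 (2*pi)" for r
        by (rule integrable_continuous) (rule continuous_on_subset[OF contc subset_UNIV])
      show "continuous_on (UNIV \<times> cbox 0 (2*pi)) (\<lambda>(r, \<theta>). cis \<theta> *s g (of_real r * cis \<theta>))"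
        unfolding split_beta
        by (intro sc.continuous_on continuous_on_compose2[OF cont] continuous_intros) auto
    qed auto
    \<comment> \<open>For \<open>r \<noteq> 0\<close> the integrand is the
      \<open>\<theta>\<close>-derivative of \<open>f (of_real r * cis \<theta>)\<close> divided by
      \<open>\<i> * of_real r\<close>, and this function takes the same value at 0 and
      \<open>2*pi\<close>. At \<open>r = 0\<close> division is impossible; there \<open>g\<close> is
      evaluated at the fixed point 0 and only \<open>cis\<close> has to be integrated.\<close>
    moreover have "((\<lambda>\<theta>. cis \<theta> *s g (of_real r * cis \<theta>)) has_integral 0) {0..2*pi}"
    proof (cases "r = 0")
      case True
      have "((\<lambda>\<theta>. cis \<theta> *s g 0) has_integral
          ((- \<i> * cis (2*pi)) *s g 0 - (- \<i> * cis 0) *s g 0)) {0..2*pi}"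
      proof (rule fundamental_theorem_of_calculus)
        show "((\<lambda>\<theta>. (- \<i> * cis \<theta>) *s g 0) has_vector_derivative cis \<theta> *s g 0)
            (at \<theta> within {0..2*pi})" for \<theta>
          unfolding has_vector_derivative_def
          by (auto intro!: derivative_eq_intros sc.FDERIV simp: sc.scaleR_left sc.minus_left sc.zero_right scaleR_conv_of_real fun_eq_iff algebra_simps scale_of_real[symmetric])
      qed auto
      then show ?thesis using True by simp
    next
      case False
      have "((\<lambda>\<theta>. (\<i> * of_real r * cis \<theta>) *s g (of_real r * cis \<theta>)) has_integral
          (f (of_real r * cis (2*pi)) - f (of_real r * cis 0))) {0..2*pi}"
      proof (rule fundamental_theorem_of_calculus)
        show "((\<lambda>\<theta>. f (of_real r * cis \<theta>)) has_vector_derivative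
            (\<i> * of_real r * cis \<theta>) *s g (of_real r * cis \<theta>)) (at \<theta> within {0..2*pi})" for \<theta>
          by (rule vderiv) (auto intro!: derivative_eq_intros simp: has_vector_derivative_def scaleR_conv_of_real algebra_simps)
      qed auto
      then have "((\<lambda>\<theta>. (\<i> * of_real r * cis \<theta>) *s g (of_real r * cis \<theta>)) has_integral 0) {0..2*pi}"
        by simp
      from has_integral_linear[OF this sc.bounded_linear_right[of "1 / (\<i> * of_real r)"]] False
      show ?thesis by (simp add: o_def)
    qed
    ultimately show ?thesis by (simp add: integral_unique)
  qed
  then obtain c where c: "?F r = c" for r
    using has_vector_derivative_zero_constant[of UNIV ?F] by auto
  have F0: "?F 0 = (2*pi) *\<^sub>R f 0" by simp
  have bound: "norm (?F 0) \<le> (2*pi) * e" if "e > 0" for e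
  proof -
    \<comment> \<open>The bound is carried from the circle of radius \<open>\<bar>B\<bar>\<close> to
      radius 0. The absolute value gives points of norm at least \<open>B\<close> even if
      \<open>B\<close> is negative.\<close>
    from lim that obtain B where B: "\<And>z. B \<le> norm z \<Longrightarrow> norm (f z) < e"
      by (auto simp: tendsto_iff eventually_at_infinity)
    have "norm (integral (cbox 0 (2*pi)) (\<lambda>\<theta>. f (of_real \<bar>B\<bar> * cis \<theta>))) \<le> e * content (cbox 0 (2*pi))"
    proof (rule integrable_bound)
      show "(\<lambda>\<theta>. f (of_real \<bar>B\<bar> * cis \<theta>)) integrable_on cbox 0 (2*pi)"
        by (rule integrable_continuous) (rule continuous_on_subset[OF contc subset_UNIV])
      show "norm (f (of_real \<bar>B\<bar> * cis \<theta>)) \<le> e" for \<theta>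
        by (rule less_imp_le, rule B) (simp add: norm_mult)
    qed (use that in auto)
    moreover have "?F 0 = ?F \<bar>B\<bar>" by (simp only: c)
    ultimately show ?thesis by (simp add: mult.commute)
  qed
  have "norm (f 0) \<le> e" if "e > 0" for e
    using bound[OF that] unfolding F0 by simp
  then show "f 0 = 0"
    by (metis field_le_epsilon add_0 norm_le_zero_iff)
qed

text \<open>If x is no multiple of e, every x - c e is invertible relative to the unit e. The
  resolvent R is then entire and vanishes at infinity, so Liouville gives R 0 = 0, against R 0 * x =
  e. Working with the unit e inside the whole algebra avoids a separate type for the corner.\<close>

lemma Gelfand_Mazur_corner:
  assumes e: "e * e = e" "e \<noteq> 0" and x: "e * x = x" "x * e = x"
    and inv: "\<And>y. e * y = y \<Longrightarrow> y * e = y \<Longrightarrow> y \<noteq> 0 \<Longrightarrow>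
      \<exists>z. e * z = z \<and> z * e = z \<and> z * y = e \<and> y * z = e"
  shows "\<exists>c. x = c *s e"
proof (rule ccontr)
  assume no: "\<nexists>c. x = c *s e"
  interpret sc: bounded_bilinear scale by (rule bounded_bilinear_scale)
  have "\<exists>z. e * z = z \<and> z * e = z \<and> z * (x - c *s e) = e \<and> (x - c *s e) * z = e" for c
    by (rule inv) (use no e x in \<open>auto simp: algebra_simps scale_mult\<close>)
  then obtain R where R: "e * R c = R c" "R c * e = R c" "R c * (x - c *s e) = e"
    "(x - c *s e) * R c = e" for c
    by metis
  have resolvent: "R b - R a = (b - a) *s (R b * R a)" for a b
  proof -
    have "R b * ((x - a *s e) - (x - b *s e)) * R a = R b - R a"
      using R(1,2,3,4) by (metis right_diff_distrib left_diff_distrib mult.assoc)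
    moreover have "R b * ((x - a *s e) - (x - b *s e)) * R a = R b * ((b - a) *s e) * R a"
      by (simp add: scale_left_diff_distrib)
    moreover have "\<dots> = (b - a) *s (R b * R a)"
      by (simp add: scale_mult R)
    ultimately show ?thesis by simp
  qed
  have lip: "norm (R b - R a) \<le> norm (b - a) * (norm (R b) * norm (R a))" for a b
    unfolding resolvent norm_scale by (intro mult_left_mono norm_mult_ineq) auto
  have cont: "(R \<longlongrightarrow> R a) (at a)" for a
  proof -
    \<comment> \<open>The estimate \<open>lip\<close> still contains \<open>norm (R b)\<close>.
      Close to a, absorbing that term into the left-hand side gives
      \<open>norm (R b) \<le> 2 * norm (R a)\<close>, and the bound becomes linear in
      \<open>norm (b - a)\<close>.\<close>
    have "norm (R b - R a) \<le> norm (b - a) * (2 * norm (R a) * norm (R a))"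
      if b: "norm (b - a) * norm (R a) \<le> 1/2" for b
    proof -
      have "norm (R b) \<le> norm (R a) + norm (R b - R a)"
        by (metis add.commute diff_add_cancel norm_triangle_ineq)
      also have "\<dots> \<le> norm (R a) + (norm (b - a) * norm (R a)) * norm (R b)"
        using lip[of b a] by (simp add: mult_ac)
      also have "\<dots> \<le> norm (R a) + 1/2 * norm (R b)"
        by (intro add_left_mono mult_right_mono b) auto
      finally have "norm (R b) \<le> 2 * norm (R a)" by simp
      then show ?thesis
        by (intro order_trans[OF lip] mult_left_mono mult_right_mono) auto
    qed
    moreover have "((\<lambda>b. norm (b - a) * norm (R a)) \<longlongrightarrow> norm (a - a) * norm (R a)) (at a)"
      by (intro tendsto_intros)
    then have "\<forall>\<^sub>F b in at a. norm (b - a) * norm (R a) < 1/2"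
      by (rule order_tendstoD) simp
    ultimately have "\<forall>\<^sub>F b in at a. norm (R b - R a) \<le> norm (b - a) * (2 * norm (R a) * norm (R a))"
      by (simp add: eventually_mono)
    moreover have "((\<lambda>b. norm (b - a) * (2 * norm (R a) * norm (R a))) \<longlongrightarrow>
        norm (a - a) * (2 * norm (R a) * norm (R a))) (at a)"
      by (intro tendsto_intros)
    then have "((\<lambda>b. norm (b - a) * (2 * norm (R a) * norm (R a))) \<longlongrightarrow> 0) (at a)"
      by simp
    ultimately have "((\<lambda>b. R b - R a) \<longlongrightarrow> 0) (at a)"
      by (rule Lim_null_comparison)
    then show ?thesis by (simp add: LIM_zero_iff)
  qed
  have "R 0 = 0"
  proof (rule Liouville_vector_valued)
    show "(R has_derivative (\<lambda>h. h *s (R a * R a))) (at a)" for a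
    proof (rule has_derivativeI_sandwich[of 1])
      show "bounded_linear (\<lambda>h. h *s (R a * R a))" by (rule sc.bounded_linear_left)
      show "norm (R b - R a - (b - a) *s (R a * R a)) / norm (b - a)
          \<le> norm (R b - R a) * norm (R a)" if "b \<noteq> a" for b
      proof -
        \<comment> \<open>By the resolvent identity the remainder has the factor
          \<open>R b - R a\<close> besides \<open>b - a\<close>, so it is of smaller order by
          continuity.\<close>
        have "R b - R a - (b - a) *s (R a * R a) = (b - a) *s ((R b - R a) * R a)"
          by (subst resolvent[of b a]) (simp add: left_diff_distrib scale_right_diff_distrib)
        then show ?thesis using that by (simp add: norm_scale norm_mult_ineq)
      qed
      have "((\<lambda>b. norm (R b - R a) * norm (R a)) \<longlongrightarrow> norm (R a - R a) * norm (R a)) (at a)"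
        by (intro tendsto_intros cont)
      then show "((\<lambda>b. norm (R b - R a) * norm (R a)) \<longlongrightarrow> 0) (at a)" by simp
    qed simp
    have "continuous_on UNIV R"
      using cont by (simp add: continuous_on_def)
    then show "continuous_on UNIV (\<lambda>a. R a * R a)"
      by (intro continuous_intros)
    have "norm (R a) \<le> 2 * norm e * inverse (norm a)" if a: "norm a > 2 * norm x" for a
    proof -
      have "a *s R a = x * R a - e"
        using R(4)[of a] R(1)[of a] by (simp add: algebra_simps scale_mult)
      then have "norm a * norm (R a) \<le> norm x * norm (R a) + norm e"
        by (metis norm_scale norm_triangle_ineq4 norm_mult_ineq add_right_mono order_trans)
      also have "\<dots> \<le> norm a / 2 * norm (R a) + norm e"
        using a by (intro add_right_mono mult_right_mono) auto
      finally have "norm a * norm (R a) \<le> 2 * norm e" by simp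
      moreover have "norm a > 0" using a norm_ge_zero[of x] by linarith
      ultimately show ?thesis by (simp add: field_simps)
    qed
    then have "\<forall>\<^sub>F a in at_infinity. norm (R a) \<le> 2 * norm e * inverse (norm a)"
      unfolding eventually_at_infinity by (intro exI[of _ "2 * norm x + 1"]) auto
    moreover have "((\<lambda>a::complex. 2 * norm e * inverse (norm a)) \<longlongrightarrow> 2 * norm e * 0) at_infinity"
      by (intro tendsto_mult tendsto_const tendsto_inverse_0_at_top filterlim_norm_at_top)
    then have "((\<lambda>a::complex. 2 * norm e * inverse (norm a)) \<longlongrightarrow> 0) at_infinity"
      by simp
    ultimately show "(R \<longlongrightarrow> 0) at_infinity"
      by (rule Lim_null_comparison)
  qed
  with R(3)[of 0] e show False by simp
qed

section \<open>Semiprimeness, minimal left ideals and minimal idempotents\<close>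

text \<open>If a is outside a maximal left ideal L, then L + A a is the whole algebra and 1 = l + b
  a with l in L. Since a b a = 0, the element b a has square zero, so l = 1 - b a has the left
  inverse 1 + b a and L contains 1. Hence a lies in the radical.\<close>

lemma semiprime:
  fixes a :: 'a
  assumes "semisimple" and aAa: "\<And>b. a * b * a = 0"
  shows "a = 0"
proof -
  have "a \<in> L" if L: "maximal_left_ideal L" for L
  proof (rule ccontr)
    assume a: "a \<notin> L"
    let ?J = "{l + b * a | l b. l \<in> L}"
    have L': "subspace L" "\<And>b l. l \<in> L \<Longrightarrow> b * l \<in> L"
      using L by (auto simp: maximal_left_ideal_def left_ideal_def)
    have "left_ideal ?J"
      unfolding left_ideal_def
    proof (intro conjI subspaceI allI ballI)
      show "0 \<in> ?J" using subspace_0[OF L'(1)] by (auto intro!: exI[of _ 0])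
      show "u + v \<in> ?J" if uv: "u \<in> ?J" "v \<in> ?J" for u v
      proof -
        from uv obtain l b l' b' where "u = l + b * a" "v = l' + b' * a" "l \<in> L" "l' \<in> L" by auto
        then have "u + v = (l + l') + (b + b') * a" "l + l' \<in> L"
          by (auto simp: algebra_simps subspace_add[OF L'(1)])
        then show ?thesis by blast
      qed
      show "c *s u \<in> ?J" if u: "u \<in> ?J" for c u
      proof -
        from u obtain l b where "u = l + b * a" "l \<in> L" by auto
        then have "c *s u = c *s l + (c *s b) * a" "c *s l \<in> L"
          by (auto simp: scale_right_distrib scale_mult subspace_scale[OF L'(1)])
        then show ?thesis by blast
      qed
      show "c * u \<in> ?J" if u: "u \<in> ?J" for c u
      proof -
        from u obtain l b where "u = l + b * a" "l \<in> L" by auto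
        then have "c * u = c * l + (c * b) * a" "c * l \<in> L"
          by (auto simp: algebra_simps L')
        then show ?thesis by blast
      qed
    qed
    moreover have "l \<in> ?J" if "l \<in> L" for l
      using that by (intro CollectI exI[of _ l] exI[of _ 0]) simp
    then have "L \<subseteq> ?J" by blast
    ultimately have "?J = L \<or> ?J = UNIV"
      using L unfolding maximal_left_ideal_def by blast
    moreover have "a \<in> ?J"
      using subspace_0[OF L'(1)] by (intro CollectI exI[of _ 0] exI[of _ 1]) simp
    with a have "?J \<noteq> L" by blast
    ultimately have "1 \<in> ?J" by blast
    then obtain l b where lb: "1 = l + b * a" "l \<in> L" by blast
    have "a * (b * a) = 0" by (metis aAa mult.assoc)
    moreover have "l = 1 - b * a" by (simp add: eq_diff_eq lb(1))
    ultimately have "(1 + b * a) * l = 1"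
      by (simp add: distrib_right right_diff_distrib mult.assoc)
    then have "1 \<in> L" using L'(2)[OF lb(2)] by metis
    then have "L = UNIV" using L'(2) by (metis UNIV_eq_I mult_1_right)
    then show False using L by (simp add: maximal_left_ideal_def)
  qed
  then have "a \<in> radical" by (auto simp: radical_def)
  then show ?thesis using assms(1) by (simp add: semisimple_def)
qed

text \<open>Minimality is expressed through the corner e A e and not through the ideal A e, because
  the scalars c serve as matrix entries later. Gelfand-Mazur supplies this form in
  \<open>minimal_left_ideal_min_idem\<close>.\<close>

definition min_idem :: "'a \<Rightarrow> bool" where
  "min_idem e \<longleftrightarrow> e \<noteq> 0 \<and> e * e = e \<and> (\<forall>a. \<exists>c. e * a * e = c *s e)"

lemma left_ideal_principal: "left_ideal {a * x | a. True}"
  unfolding left_ideal_def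
proof (intro conjI subspaceI allI ballI)
  let ?L = "{a * x | a. True}"
  show "0 \<in> ?L" using mult_zero_left[of x] by (metis (mono_tags) mem_Collect_eq)
  show "u + v \<in> ?L" if "u \<in> ?L" "v \<in> ?L" for u v
    using that by (auto simp flip: distrib_right)
  show "c *s u \<in> ?L" if "u \<in> ?L" for c u
    using that by (auto simp flip: scale_mult_left)
  show "c * u \<in> ?L" if "u \<in> ?L" for c u
    using that by (auto simp flip: mult.assoc)
qed

lemma minimal_left_ideal_generator:
  assumes L: "minimal_left_ideal L" and x: "x \<in> L" "x \<noteq> 0"
  shows "L = {a * x | a. True}"
proof -
  have "{a * x | a. True} \<subseteq> L" using L x(1)
    by (auto simp: minimal_left_ideal_def left_ideal_def)
  moreover have "x \<in> {a * x | a. True}" by (metis (mono_tags) mem_Collect_eq mult_1_left)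
  ultimately show ?thesis
    using L left_ideal_principal[of x] x(2) unfolding minimal_left_ideal_def by blast
qed

text \<open>Semiprimeness gives a, x in L with a x nonzero, so L = A a x and x = e x for some e = c
  a. The elements of L that annihilate x from the left form a left ideal inside L without a, hence
  zero; as e e - e is one of them, e is idempotent. Every nonzero y in e A e generates L, so e A e
  is a division algebra and Gelfand-Mazur applies.\<close>

lemma minimal_left_ideal_min_idem:
  assumes "semisimple" and L: "minimal_left_ideal L"
  obtains e where "min_idem e" "e \<in> L" "L = {a * e | a. True}"
proof -
  have L': "subspace L" "\<And>b l. l \<in> L \<Longrightarrow> b * l \<in> L" "L \<noteq> {0}"
    "\<And>J. left_ideal J \<Longrightarrow> J \<subseteq> L \<Longrightarrow> J = {0} \<or> J = L"
    using L by (auto simp: minimal_left_ideal_def left_ideal_def)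
  obtain a where a: "a \<in> L" "a \<noteq> 0" using L'(1,3) subspace_0 by blast
  obtain b where b: "a * b * a \<noteq> 0" using semiprime[OF assms(1)] a(2) by blast
  define x where "x = b * a"
  have x: "x \<in> L" "a * x \<noteq> 0" "x \<noteq> 0" using L'(2)[OF a(1)] b by (auto simp: x_def mult.assoc)
  have "L = {c * (a * x) | c. True}"
    by (rule minimal_left_ideal_generator[OF L]) (use x L' in auto)
  then obtain c where c: "x = c * (a * x)" using x(1) by blast
  define e where "e = c * a"
  have e: "e \<in> L" "e * x = x" using L'(2)[OF a(1)] c by (auto simp: e_def mult.assoc)
  have e0: "e \<noteq> 0" using e x by auto
  have "left_ideal {l \<in> L. l * x = 0}"
    unfolding left_ideal_def
    by (auto intro!: subspaceI simp: subspace_0 subspace_add subspace_scale L' distrib_right scale_mult mult.assoc)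
  moreover have "a \<notin> {l \<in> L. l * x = 0}" using x by auto
  ultimately have "{l \<in> L. l * x = 0} = {0}" using L'(4) a(1) by blast
  moreover have "e * e - e \<in> {l \<in> L. l * x = 0}"
    using e L' by (auto simp: left_diff_distrib mult.assoc subspace_diff)
  ultimately have ee: "e * e = e" by auto
  have gen: "L = {a * y | a. True}" if "y \<in> L" "y \<noteq> 0" for y
    using minimal_left_ideal_generator[OF L that] .
  have linv: "\<exists>z. e * z = z \<and> z * e = z \<and> z * y = e" if y: "e * y = y" "y * e = y" "y \<noteq> 0" for y
  proof -
    have "y \<in> L" using L'(2)[OF e(1)] y(2) by metis
    then obtain z where z: "e = z * y" using gen[of y] y(3) e(1) by blast
    have "e * z * e * y = e" using z y by (metis ee mult.assoc)
    then show ?thesis by (intro exI[of _ "e * z * e"]) (simp add: mult.assoc ee, metis ee mult.assoc)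
  qed
  have inv: "\<exists>z. e * z = z \<and> z * e = z \<and> z * y = e \<and> y * z = e"
    if y: "e * y = y" "y * e = y" "y \<noteq> 0" for y
  proof -
    obtain z where z: "e * z = z" "z * e = z" "z * y = e" using linv[OF y] by blast
    moreover have "z \<noteq> 0" using z e0 by auto
    ultimately obtain w where w: "e * w = w" "w * e = w" "w * z = e" using linv[of z] by blast
    \<comment> \<open>The left inverse w of the left inverse z of y must be y itself, so z is a
      two-sided inverse.\<close>
    have "w = y" using w z y by (metis mult.assoc)
    with w z show ?thesis by blast
  qed
  have "\<exists>c. e * u * e = c *s e" for u
    by (rule Gelfand_Mazur_corner[OF ee e0 _ _ inv]) (simp_all add: mult.assoc ee, metis ee mult.assoc)
  then have "min_idem e" using e0 ee by (simp add: min_idem_def)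
  then show ?thesis using that e gen[OF e(1) e0] by blast
qed

text \<open>Choose b with x b x nonzero. Then e b x = e b x e is a multiple of e, and a nonzero one
  because x times it is x b x; rescaling b gives the claim. It recovers e from any nonzero element
  of A e.\<close>

lemma min_idem_left_unit:
  assumes "semisimple" "min_idem e" and x: "x * e = x" "x \<noteq> 0"
  obtains b where "e * b * x = e"
proof -
  obtain b where b: "x * b * x \<noteq> 0" using semiprime[OF assms(1)] x(2) by blast
  obtain c where c: "e * (b * x) * e = c *s e" using assms(2) unfolding min_idem_def by blast
  then have c': "e * b * x = c *s e" by (simp add: mult.assoc x)
  have "c \<noteq> 0"
  proof
    assume "c = 0"
    then have "x * (e * b * x) = 0" using c' by simp
    then show False using b x(1) by (metis mult.assoc)
  qed
  then have "e * ((1/c) *s b) * x = e" using c' by (simp add: scale_mult)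
  then show ?thesis using that by blast
qed

lemma min_idem_right_unit:
  assumes "semisimple" "min_idem e" and x: "e * x = x" "x \<noteq> 0"
  obtains b where "x * b * e = e"
proof -
  obtain b where b: "x * b * x \<noteq> 0" using semiprime[OF assms(1)] x(2) by blast
  obtain c where c: "e * (x * b) * e = c *s e" using assms(2) unfolding min_idem_def by blast
  then have c': "x * b * e = c *s e" by (metis x(1) mult.assoc)
  have "c \<noteq> 0"
  proof
    assume "c = 0"
    then have "(x * b * e) * x = 0" using c' by simp
    then show False using b x(1) by (metis mult.assoc)
  qed
  then have "x * ((1/c) *s b) * e = e" using c' by (simp add: scale_mult)
  then show ?thesis using that by blast
qed

text \<open>Think of \<open>\<xi>\<close> as a column and \<open>\<eta>\<close> as a row over the
  scalars e A e, so that \<open>\<xi> * \<eta>\<close> is a rank one idempotent. Its corner is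
  scalar because \<open>\<eta> * a * \<xi>\<close> lies in e A e. All minimal idempotents
  constructed below arise in this way.\<close>

lemma min_idem_transfer:
  assumes e: "min_idem e" and "\<eta> * \<xi> = e" "e * \<eta> = \<eta>" "\<xi> * e = \<xi>"
  shows "min_idem (\<xi> * \<eta>)"
  unfolding min_idem_def
proof (intro conjI allI)
  have ee: "e * e = e" "e \<noteq> 0" using e by (auto simp: min_idem_def)
  show "\<xi> * \<eta> \<noteq> 0" using assms ee by (metis mult.assoc mult_zero_left mult_zero_right)
  show "\<xi> * \<eta> * (\<xi> * \<eta>) = \<xi> * \<eta>" using assms by (metis mult.assoc)
  fix a
  obtain c where c: "e * (\<eta> * a * \<xi>) * e = c *s e" using e unfolding min_idem_def by blast
  have "\<xi> * \<eta> * a * (\<xi> * \<eta>) = \<xi> * (e * (\<eta> * a * \<xi>) * e) * \<eta>"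
    using assms by (metis mult.assoc)
  also have "\<dots> = c *s (\<xi> * \<eta>)" by (simp add: c scale_mult assms)
  finally show "\<exists>c. \<xi> * \<eta> * a * (\<xi> * \<eta>) = c *s (\<xi> * \<eta>)" by blast
qed

text \<open>The left ideal A e is minimal: by \<open>min_idem_left_unit\<close>, a left ideal that
  contains a nonzero x in A e contains e.\<close>

lemma min_idem_in_socle:
  assumes "semisimple" and e: "min_idem e"
  shows "e \<in> socle"
proof -
  let ?L = "{a * e | a. True}"
  have eL: "e \<in> ?L" by (metis (mono_tags) mem_Collect_eq mult_1_left)
  have e': "e \<noteq> 0" "e * e = e" using e by (auto simp: min_idem_def)
  have "minimal_left_ideal ?L"
    unfolding minimal_left_ideal_def
  proof (intro conjI allI impI)
    show "left_ideal ?L" by (rule left_ideal_principal)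
    show "?L \<noteq> {0}" using eL e' by blast
    fix J assume J: "left_ideal J \<and> J \<subseteq> ?L"
    then have J': "0 \<in> J" "\<And>b l. l \<in> J \<Longrightarrow> b * l \<in> J" by (auto simp: left_ideal_def subspace_0)
    show "J = {0} \<or> J = ?L"
    proof (cases "J \<subseteq> {0}")
      case False
      then obtain x where x: "x \<in> J" "x \<noteq> 0" by auto
      then obtain a where "x = a * e" using J by blast
      then have xe: "x * e = x" using e' by (simp add: mult.assoc)
      obtain b where b: "e * b * x = e" using min_idem_left_unit[OF assms xe x(2)] .
      then have "e \<in> J" using J'(2)[OF x(1), of "e * b"] by simp
      then have "?L \<subseteq> J" using J'(2) by auto
      then show ?thesis using J by blast
    qed (use J' in auto)
  qed
  then show ?thesis unfolding socle_def using eL by (intro span_base) blast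
qed

lemma socle_left_mult: "x \<in> socle \<Longrightarrow> a * x \<in> socle"
  unfolding socle_def
proof (induction rule: span_induct_alt)
  case (step c x y)
  then have "a * x \<in> \<Union> {L. minimal_left_ideal L}"
    by (auto simp: minimal_left_ideal_def left_ideal_def)
  then have "c *s (a * x) + a * y \<in> span (\<Union> {L. minimal_left_ideal L})"
    using step by (intro span_add span_scale) (auto intro: span_base)
  then show ?case by (simp add: distrib_left scale_mult)
qed (simp add: span_zero)

section \<open>Orthogonal families of minimal idempotents as local units of the socle\<close>

definition orth_family :: "'a set \<Rightarrow> bool" where
  "orth_family F \<longleftrightarrow> finite F \<and> (\<forall>f\<in>F. min_idem f) \<and> (\<forall>f\<in>F. \<forall>g\<in>F. f \<noteq> g \<longrightarrow> f * g = 0)"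

lemma orth_family_mult:
  assumes "orth_family F" "f \<in> F" "g \<in> F"
  shows "f * g = (if f = g then f else 0)"
  using assms by (auto simp: orth_family_def min_idem_def)

lemma orth_family_subset: "orth_family F \<Longrightarrow> G \<subseteq> F \<Longrightarrow> orth_family G"
  unfolding orth_family_def by (meson finite_subset subsetD)

lemma orth_family_sum_mult:
  assumes F: "orth_family F" "G \<subseteq> F" "f \<in> F"
  shows "f * \<Sum>G = (if f \<in> G then f else 0)" "\<Sum>G * f = (if f \<in> G then f else 0)"
proof -
  have fin: "finite G" using F by (auto simp: orth_family_def finite_subset)
  have "f * \<Sum>G = (\<Sum>g\<in>G. if f = g then f else 0)"
    unfolding sum_distrib_left using F by (intro sum.cong refl orth_family_mult[OF F(1)]) auto
  then show "f * \<Sum>G = (if f \<in> G then f else 0)" using fin by simp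
  have "\<Sum>G * f = (\<Sum>g\<in>G. if g = f then g else 0)"
    unfolding sum_distrib_right using F by (intro sum.cong refl orth_family_mult[OF F(1)]) auto
  then show "\<Sum>G * f = (if f \<in> G then f else 0)" using fin by simp
qed

lemma orth_family_subset_sum:
  assumes F: "orth_family F" "G \<subseteq> F"
  shows "\<Sum>G * \<Sum>F = \<Sum>G" "\<Sum>F * \<Sum>G = \<Sum>G"
proof -
  have "\<Sum>G * \<Sum>F = (\<Sum>g\<in>G. g)"
    unfolding sum_distrib_right using F
    by (intro sum.cong refl) (auto simp: orth_family_sum_mult[OF F(1) subset_refl] subset_iff)
  then show "\<Sum>G * \<Sum>F = \<Sum>G" by simp
  have "\<Sum>F * \<Sum>G = (\<Sum>g\<in>G. g)"
    unfolding sum_distrib_left using F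
    by (intro sum.cong refl) (auto simp: orth_family_sum_mult[OF F(1) subset_refl] subset_iff)
  then show "\<Sum>F * \<Sum>G = \<Sum>G" by simp
qed

lemma orth_family_insert:
  assumes F: "orth_family F" and p: "min_idem p" "\<Sum>F * p = 0" "p * \<Sum>F = 0"
  shows "orth_family (insert p F)" "p \<notin> F"
proof -
  have fp: "f * p = 0" "p * f = 0" if "f \<in> F" for f
  proof -
    have "f * \<Sum>F = f" "\<Sum>F * f = f" using orth_family_sum_mult[OF F subset_refl that] that by auto
    then show "f * p = 0" "p * f = 0"
      using p(2,3) by (metis mult.assoc mult_zero_right, metis mult.assoc mult_zero_left)
  qed
  show "p \<notin> F" using fp[of p] p by (auto simp: min_idem_def)
  show "orth_family (insert p F)"
    using F p fp unfolding orth_family_def by auto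
qed

text \<open>A Gram-Schmidt step. The part h = g - e g of g missed by e = \<open>\<Sum>F\<close> is
  completed to a minimal idempotent \<open>h * \<eta>\<close> orthogonal to e. Adjoining it
  suffices, because \<open>h * \<eta> * g = h\<close> and h + e g = g.\<close>

lemma orth_family_extend_left:
  assumes "semisimple" and F: "orth_family F" and g: "min_idem g"
  shows "\<exists>G. F \<subseteq> G \<and> orth_family G \<and> \<Sum>G * g = g"
proof (cases "\<Sum>F * g = g")
  case False
  define e where "e = \<Sum>F"
  have ee: "e * e = e" using orth_family_subset_sum[OF F subset_refl] by (simp add: e_def)
  have gg: "g * g = g" using g by (simp add: min_idem_def)
  define h where "h = g - e * g"
  have h: "h * g = h" "h \<noteq> 0" "e * h = 0"
  proof -
    show "h * g = h" by (simp add: h_def left_diff_distrib mult.assoc gg)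
    show "h \<noteq> 0" using False by (metis h_def e_def right_minus_eq)
    show "e * h = 0" by (simp add: h_def right_diff_distrib mult.assoc[symmetric] ee)
  qed
  obtain b where b: "g * b * h = g" using min_idem_left_unit[OF assms(1) g h(1,2)] .
  \<comment> \<open>The subtracted term forces \<open>\<eta> * e = 0\<close>, and it leaves
    \<open>\<eta> * h\<close> unchanged since e h = 0.\<close>
  define \<eta> where "\<eta> = g * b - g * b * e"
  have \<eta>: "\<eta> * h = g" "g * \<eta> = \<eta>" "\<eta> * e = 0"
  proof -
    show "\<eta> * h = g" using b by (simp add: \<eta>_def left_diff_distrib mult.assoc h(3))
    show "g * \<eta> = \<eta>" by (simp add: \<eta>_def right_diff_distrib mult.assoc[symmetric] gg)
    show "\<eta> * e = 0" by (simp add: \<eta>_def left_diff_distrib mult.assoc ee)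
  qed
  have p: "min_idem (h * \<eta>)" by (rule min_idem_transfer[OF g \<eta>(1,2) h(1)])
  have pe: "\<Sum>F * (h * \<eta>) = 0" "h * \<eta> * \<Sum>F = 0"
    unfolding e_def[symmetric] using h(3) \<eta>(3) by (metis mult.assoc mult_zero_left, metis mult.assoc mult_zero_right)
  note ins = orth_family_insert[OF F p pe]
  have "\<Sum>(insert (h * \<eta>) F) = h * \<eta> + e"
    using ins F by (simp add: e_def orth_family_def)
  moreover have "(h * \<eta> + e) * g = g"
  proof -
    have "\<eta> * g = \<eta> * h + \<eta> * e * g" by (simp add: h_def right_diff_distrib mult.assoc)
    then have "\<eta> * g = g" by (simp add: \<eta>)
    then show ?thesis by (simp add: distrib_right mult.assoc h(1)) (simp add: h_def)
  qed
  ultimately show ?thesis using ins by (intro exI[of _ "insert (h * \<eta>) F"]) auto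
qed (use F in auto)

lemma orth_family_extend_right:
  assumes "semisimple" and F: "orth_family F" and g: "min_idem g"
  shows "\<exists>G. F \<subseteq> G \<and> orth_family G \<and> g * \<Sum>G = g"
proof (cases "g * \<Sum>F = g")
  case False
  define e where "e = \<Sum>F"
  have ee: "e * e = e" using orth_family_subset_sum[OF F subset_refl] by (simp add: e_def)
  have gg: "g * g = g" using g by (simp add: min_idem_def)
  define h where "h = g - g * e"
  have h: "g * h = h" "h \<noteq> 0" "h * e = 0"
  proof -
    show "g * h = h" by (simp add: h_def right_diff_distrib mult.assoc[symmetric] gg)
    show "h \<noteq> 0" using False by (metis h_def e_def right_minus_eq)
    show "h * e = 0" by (simp add: h_def left_diff_distrib mult.assoc ee)
  qed
  obtain b where b: "h * b * g = g" using min_idem_right_unit[OF assms(1) g h(1,2)] .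
  define \<xi> where "\<xi> = b * g - e * b * g"
  have \<xi>: "h * \<xi> = g" "\<xi> * g = \<xi>" "e * \<xi> = 0"
  proof -
    show "h * \<xi> = g" using b by (simp add: \<xi>_def right_diff_distrib mult.assoc[symmetric] h(3))
    show "\<xi> * g = \<xi>" by (simp add: \<xi>_def left_diff_distrib mult.assoc gg)
    show "e * \<xi> = 0" by (simp add: \<xi>_def right_diff_distrib mult.assoc[symmetric] ee)
  qed
  have p: "min_idem (\<xi> * h)" by (rule min_idem_transfer[OF g \<xi>(1) h(1) \<xi>(2)])
  have pe: "\<Sum>F * (\<xi> * h) = 0" "\<xi> * h * \<Sum>F = 0"
    unfolding e_def[symmetric] using h(3) \<xi>(3) by (metis mult.assoc mult_zero_left, metis mult.assoc mult_zero_right)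
  note ins = orth_family_insert[OF F p pe]
  have "\<Sum>(insert (\<xi> * h) F) = \<xi> * h + e"
    using ins F by (simp add: e_def orth_family_def)
  moreover have "g * (\<xi> * h + e) = g"
  proof -
    have "g * \<xi> = h * \<xi> + g * (e * \<xi>)" by (simp add: h_def left_diff_distrib mult.assoc)
    then have "g * \<xi> = g" by (simp add: \<xi>)
    then show ?thesis by (simp add: distrib_left mult.assoc[symmetric] h(1)) (simp add: h_def)
  qed
  ultimately show ?thesis using ins by (intro exI[of _ "insert (\<xi> * h) F"]) auto
qed (use F in auto)

text \<open>Units for earlier elements survive when the family grows, so the terms of a span can be
  treated one after another. The same fact is the reason for starting from an arbitrary family F: it
  allows several socle elements to share one unit.\<close>

lemma socle_orth_family_unit:
  assumes "semisimple" and "x \<in> socle" "orth_family F"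
  shows "\<exists>G. F \<subseteq> G \<and> orth_family G \<and> \<Sum>G * x = x \<and> x * \<Sum>G = x"
  using assms(2,3) unfolding socle_def
proof (induction arbitrary: F rule: span_induct_alt)
  case base
  then show ?case by (intro exI[of _ F]) auto
next
  case (step c x y)
  have keep: "\<Sum>G' * z = z" if "orth_family G'" "G \<subseteq> G'" "\<Sum>G * z = z" for G G' z
    using orth_family_subset_sum(2)[OF that(1,2)] that(3) by (metis mult.assoc)
  have keep': "z * \<Sum>G' = z" if "orth_family G'" "G \<subseteq> G'" "z * \<Sum>G = z" for G G' z
    using orth_family_subset_sum(1)[OF that(1,2)] that(3) by (metis mult.assoc)
  obtain G1 where G1: "F \<subseteq> G1" "orth_family G1" "\<Sum>G1 * y = y" "y * \<Sum>G1 = y"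
    using step by blast
  have "\<exists>G. G1 \<subseteq> G \<and> orth_family G \<and> \<Sum>G * x = x \<and> x * \<Sum>G = x"
  proof (cases "x = 0")
    case True
    then show ?thesis using G1 by (intro exI[of _ G1]) auto
  next
    case False
    obtain L where L: "minimal_left_ideal L" "x \<in> L" using step(1) by blast
    obtain e a where e: "min_idem e" "x = a * e"
      using minimal_left_ideal_min_idem[OF assms(1) L(1)] L(2) by blast
    have xe: "x * e = x" using e by (simp add: mult.assoc min_idem_def)
    obtain b where b: "e * b * x = e" using min_idem_left_unit[OF assms(1) e(1) xe False] .
    \<comment> \<open>A nonzero x in A e satisfies x = p x = x e with the minimal idempotent p = x e
      b. It is therefore enough that the enlarged family fixes p from the left and e from the
      right.\<close>
    have p: "min_idem (x * (e * b))"
      using e(1) b xe by (intro min_idem_transfer[of e]) (auto simp: min_idem_def mult.assoc[symmetric])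
    have px: "x * (e * b) * x = x" using b xe by (metis mult.assoc)
    obtain G2 where G2: "G1 \<subseteq> G2" "orth_family G2" "e * \<Sum>G2 = e"
      using orth_family_extend_right[OF assms(1) G1(2) e(1)] by blast
    obtain G3 where G3: "G2 \<subseteq> G3" "orth_family G3" "\<Sum>G3 * (x * (e * b)) = x * (e * b)"
      using orth_family_extend_left[OF assms(1) G2(2) p] by blast
    have "e * \<Sum>G3 = e" using keep'[OF G3(2,1) G2(3)] .
    then have "x * \<Sum>G3 = x" using xe by (metis mult.assoc)
    moreover have "\<Sum>G3 * x = x" using G3(3) px by (metis mult.assoc)
    ultimately show ?thesis using G3 G2 by (intro exI[of _ G3]) auto
  qed
  then obtain G where G: "G1 \<subseteq> G" "orth_family G" "\<Sum>G * x = x" "x * \<Sum>G = x" by blast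
  have "\<Sum>G * y = y" "y * \<Sum>G = y" using keep[OF G(2,1) G1(3)] keep'[OF G(2,1) G1(4)] .
  then show ?case using G G1(1) by (intro exI[of _ G]) (auto simp: algebra_simps scale_mult)
qed

section \<open>Matrix entries, blocks and the trace of a commutator\<close>

text \<open>Meaningful only when \<open>f\<close> is a minimal idempotent.\<close>

definition corner_coeff :: "'a \<Rightarrow> 'a \<Rightarrow> complex" where
  "corner_coeff f x = (THE c. f * x * f = c *s f)"

lemma corner_coeff_unique: "min_idem f \<Longrightarrow> f * x * f = c *s f \<Longrightarrow> corner_coeff f x = c"
  unfolding corner_coeff_def by (rule the_equality) (auto simp: min_idem_def)

lemma corner_coeff: "min_idem f \<Longrightarrow> f * x * f = corner_coeff f x *s f"
  using corner_coeff_unique by (metis min_idem_def)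

lemma corner_coeff_add: "min_idem f \<Longrightarrow> corner_coeff f (x + y) = corner_coeff f x + corner_coeff f y"
  by (rule corner_coeff_unique) (simp_all add: distrib_left distrib_right left_diff_distrib right_diff_distrib scale_left_distrib scale_left_diff_distrib corner_coeff)

lemma corner_coeff_diff: "min_idem f \<Longrightarrow> corner_coeff f (x - y) = corner_coeff f x - corner_coeff f y"
  by (rule corner_coeff_unique) (simp_all add: distrib_left distrib_right left_diff_distrib right_diff_distrib scale_left_distrib scale_left_diff_distrib corner_coeff)

lemma corner_coeff_sum: "min_idem f \<Longrightarrow> corner_coeff f (\<Sum>i\<in>I. h i) = (\<Sum>i\<in>I. corner_coeff f (h i))"
  by (rule corner_coeff_unique) (simp_all add: sum_distrib_left sum_distrib_right corner_coeff scale_sum_left)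

lemma corner_coeff_eq_0_iff: "min_idem f \<Longrightarrow> corner_coeff f x = 0 \<longleftrightarrow> f * x * f = 0"
  by (simp add: corner_coeff min_idem_def)

text \<open>This is the cyclic invariance of the trace for single entries. With u = f x g and v = g
  y f, the products u v and v u are multiples of f and g, and (u v) u = u (v u) identifies the
  scalars if u is nonzero. If u = 0, both vanish.\<close>

lemma corner_coeff_swap:
  assumes f: "min_idem f" and g: "min_idem g"
  shows "corner_coeff f (x * g * y) = corner_coeff g (y * f * x)"
proof -
  define u where "u = f * x * g"
  define v where "v = g * y * f"
  have uv: "u * v = corner_coeff f (x * g * y) *s f"
    using f g unfolding corner_coeff[OF f, symmetric] u_def v_def min_idem_def by (metis mult.assoc)
  have vu: "v * u = corner_coeff g (y * f * x) *s g"
    using f g unfolding corner_coeff[OF g, symmetric] u_def v_def min_idem_def by (metis mult.assoc)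
  have fu: "f * u = u" "u * g = u" using f g unfolding u_def min_idem_def by (metis mult.assoc)+
  have "corner_coeff f (x * g * y) *s u = corner_coeff g (y * f * x) *s u"
    using uv vu fu by (metis mult.assoc scale_mult)
  moreover have "corner_coeff f (x * g * y) = 0" "corner_coeff g (y * f * x) = 0" if "u = 0"
    using uv vu f g that by (auto simp: min_idem_def)
  ultimately show ?thesis by (metis scale_right_imp_eq)
qed

definition linked :: "'a \<Rightarrow> 'a \<Rightarrow> bool" where
  "linked f g \<longleftrightarrow> (\<exists>a. f * a * g \<noteq> 0)"

text \<open>Together with f and g, the elements u and v are 2 x 2 matrix units. Once v u = g is
  arranged, u v is a multiple of f, and (u v) u = u forces the factor to be 1.\<close>

lemma linked_units:
  assumes "semisimple" "min_idem f" "min_idem g" "linked f g"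
  obtains u v where "u * v = f" "v * u = g" "f * u = u" "u * g = u" "g * v = v" "v * f = v"
proof -
  have ff: "f * f = f" and gg: "g * g = g" using assms(2,3) by (auto simp: min_idem_def)
  obtain a where a: "f * a * g \<noteq> 0" using assms(4) by (auto simp: linked_def)
  define u where "u = f * a * g"
  have u: "f * u = u" "u * g = u" "u \<noteq> 0" using a ff gg by (auto simp: u_def mult.assoc) (metis mult.assoc)+
  obtain b where b: "g * b * u = g" using min_idem_left_unit[OF assms(1,3) u(2,3)] .
  define v where "v = g * b * f"
  have vu: "v * u = g" using b u by (simp add: v_def mult.assoc)
  have v: "g * v = v" "v * f = v" using ff gg by (auto simp: v_def mult.assoc) (metis mult.assoc)+
  have "u * v = f * (u * v) * f" using u v by (metis mult.assoc)
  then have uv: "u * v = corner_coeff f (u * v) *s f" using corner_coeff[OF assms(2)] by metis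
  have "corner_coeff f (u * v) *s u = 1 *s u"
    using uv vu u by (metis mult.assoc scale_mult_left scale_one)
  then have "corner_coeff f (u * v) = 1" using u(3) by (rule scale_right_imp_eq[rotated])
  then have "u * v = f" using uv by simp
  then show ?thesis using that vu u v by blast
qed

lemma linked_trans:
  assumes "semisimple" "min_idem f" "min_idem g" "linked f g" "linked g h"
  shows "linked f h"
proof -
  obtain u v where uv: "v * u = g" "f * u = u" "u * g = u"
    using linked_units[OF assms(1-4)] by metis
  obtain a where "g * a * h \<noteq> 0" using assms(5) by (auto simp: linked_def)
  then have "u * a * h \<noteq> 0" using uv by (metis mult.assoc mult_zero_right)
  then have "f * (u * a) * h \<noteq> 0" using uv by (metis mult.assoc)
  then show ?thesis unfolding linked_def by blast
qed

text \<open>Inserting the unit \<open>\<Sum>F\<close> between the factors writes each diagonal entry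
  of a product as a sum over F. Only members of the block of f contribute, and
  \<open>corner_coeff_swap\<close> turns the double sum for x y into that for y x.\<close>

lemma block_trace_commutator:
  assumes "semisimple" and F: "orth_family F" and f: "f \<in> F"
    and x: "x * \<Sum>F = x" and y: "y * \<Sum>F = y"
  shows "(\<Sum>g | g \<in> F \<and> linked f g. corner_coeff g (x * y - y * x)) = 0"
proof -
  let ?K = "{g \<in> F. linked f g}"
  have fin: "finite F" and mi: "\<And>g. g \<in> F \<Longrightarrow> min_idem g" using F by (auto simp: orth_family_def)
  have exp: "corner_coeff g (a * b) = (\<Sum>h\<in>?K. corner_coeff g (a * h * b))"
    if g: "g \<in> ?K" and a: "a * \<Sum>F = a" for g a b
  proof -
    have "a * b = a * \<Sum>F * b" by (simp add: a)
    also have "\<dots> = (\<Sum>h\<in>F. a * h * b)" by (simp add: sum_distrib_left sum_distrib_right)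
    finally have "corner_coeff g (a * b) = (\<Sum>h\<in>F. corner_coeff g (a * h * b))"
      using g by (simp add: corner_coeff_sum mi)
    also have "\<dots> = (\<Sum>h\<in>?K. corner_coeff g (a * h * b))"
    proof (rule sum.mono_neutral_right)
      \<comment> \<open>If g a h were nonzero, h would be linked to g and thus, by transitivity, to
        f.\<close>
      show "\<forall>h\<in>F - ?K. corner_coeff g (a * h * b) = 0"
      proof
        fix h assume h: "h \<in> F - ?K"
        then have "\<not> linked g h" using g linked_trans[OF assms(1) mi[OF f] mi] by blast
        then have "g * a * h = 0" by (simp add: linked_def)
        then have "g * (a * h * b) * g = 0" by (metis mult.assoc mult_zero_left)
        then show "corner_coeff g (a * h * b) = 0" using g by (simp add: corner_coeff_eq_0_iff mi)
      qed
    qed (use fin in auto)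
    finally show ?thesis .
  qed
  have "(\<Sum>g\<in>?K. corner_coeff g (x * y)) = (\<Sum>g\<in>?K. \<Sum>h\<in>?K. corner_coeff g (x * h * y))"
    by (intro sum.cong refl exp x)
  also have "\<dots> = (\<Sum>g\<in>?K. \<Sum>h\<in>?K. corner_coeff h (y * g * x))"
    by (intro sum.cong refl corner_coeff_swap mi) auto
  also have "\<dots> = (\<Sum>h\<in>?K. \<Sum>g\<in>?K. corner_coeff h (y * g * x))"
    by (rule sum.swap)
  also have "\<dots> = (\<Sum>h\<in>?K. corner_coeff h (y * x))"
    by (intro sum.cong refl exp[symmetric] y)
  finally have "(\<Sum>g\<in>?K. corner_coeff g (x * y)) = (\<Sum>g\<in>?K. corner_coeff g (y * x))" .
  then show ?thesis using mi by (simp add: corner_coeff_diff sum_subtractf)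
qed

section \<open>Removing the diagonal by 2 x 2 moves\<close>

text \<open>In the matrix units i, j, u, v the element t has a 2 x 2 matrix that is not scalar, as
  its diagonal entries differ. A change of basis then makes the first diagonal entry zero; p and q
  are the new coordinate idempotents.\<close>

lemma pair_zero_diagonal:
  assumes "semisimple" and i: "min_idem i" and j: "min_idem j" and ij: "i * j = 0" "j * i = 0"
    and link: "linked i j" and ne: "corner_coeff i t \<noteq> corner_coeff j t"
  obtains p q where "min_idem p" "min_idem q" "p * q = 0" "q * p = 0" "p + q = i + j" "p * t * p = 0"
proof -
  have ii: "i * i = i" and jj: "j * j = j" using i j by (auto simp: min_idem_def)
  obtain u v where uv: "u * v = i" "v * u = j" "i * u = u" "u * j = u" "j * v = v" "v * i = v"
    using linked_units[OF assms(1) i j link] .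
  have z: "u * i = 0" "v * j = 0" "j * u = 0" "i * v = 0" "u * u = 0" "v * v = 0"
    using uv ij by (metis mult.assoc mult_zero_right mult_zero_left)+
  note tab = ii jj ij uv z
  define a where "a = corner_coeff i t"
  define d where "d = corner_coeff j t"
  define b where "b = corner_coeff i (t * v)"
  define c where "c = corner_coeff i (u * t)"
  have ent: "i * t * i = a *s i" "i * t * v = b *s i" "u * t * i = c *s i" "u * t * v = d *s i"
  proof -
    show "i * t * i = a *s i" using i by (simp add: a_def corner_coeff)
    show "i * t * v = b *s i" using corner_coeff[OF i, of "t * v"] uv by (simp add: b_def mult.assoc)
    show "u * t * i = c *s i" using corner_coeff[OF i, of "u * t"] uv by (simp add: c_def mult.assoc[symmetric])
    have "u * t * v = u * (j * t * j) * v" using uv by (metis mult.assoc)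
    then show "u * t * v = d *s i" by (simp add: corner_coeff[OF j] d_def scale_mult uv)
  qed
  \<comment> \<open>The rank one idempotent with column \<open>(1, s)\<close> and row \<open>(1 - s m, m)\<close> annihilates the matrix
    with rows \<open>(a, b)\<close>, \<open>(c, d)\<close> of \<open>t\<close> when a linear equation for \<open>m\<close> holds, whose leading
    coefficient is this quadratic in \<open>s\<close>.\<close>
  have "\<exists>s\<in>{0,1,-1}. c + (d - a) * s - b * s * s \<noteq> 0"
  proof (rule ccontr)
    assume "\<not> ?thesis"
    then have "c = 0" "c + (d - a) - b = 0" "c - (d - a) - b = 0" by auto
    \<comment> \<open>A quadratic that vanishes at 0, 1 and -1 is zero, but the linear coefficient
      here is \<open>d - a\<close>.\<close>
    then have "2 * (d - a) = 0" by algebra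
    then show False using ne by (simp add: a_def d_def)
  qed
  then obtain s where s: "c + (d - a) * s - b * s * s \<noteq> 0" by blast
  define m where "m = - (a + b * s) / (c + (d - a) * s - b * s * s)"
  define k where "k = 1 - s * m"
  have m: "k * a + k * s * b + m * c + m * s * d = 0"
  proof -
    have "m * (c + (d - a) * s - b * s * s) = - (a + b * s)" using s by (simp add: m_def)
    then show ?thesis unfolding k_def by algebra
  qed
  \<comment> \<open>The columns (1, s) and (-m, k) form a matrix of determinant k + s m = 1, and its
    inverse has the rows (k, m) and (-s, 1). These are \<open>\<xi>\<close>, \<open>\<xi>'\<close>
    and \<open>\<eta>\<close>, \<open>\<eta>'\<close>.\<close>
  define \<xi> where "\<xi> = i + s *s v"
  define \<eta> where "\<eta> = k *s i + m *s u"
  define \<xi>' where "\<xi>' = k *s j - m *s u"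
  define \<eta>' where "\<eta>' = j - s *s v"
  note defs = \<xi>_def \<eta>_def \<xi>'_def \<eta>'_def
  note dist = distrib_left distrib_right left_diff_distrib right_diff_distrib
    scale_right_distrib scale_right_diff_distrib scale_mult tab
  have ki: "k *s x + (s * m) *s x = x" for x
    by (simp add: k_def flip: scale_left_distrib)
  have prods: "\<eta> * \<xi> = i" "\<eta>' * \<xi>' = j" "\<eta> * \<xi>' = 0" "\<eta>' * \<xi> = 0"
    using ki[of i] ki[of j] by (simp_all add: defs dist mult_ac)
  have sides: "i * \<eta> = \<eta>" "\<xi> * i = \<xi>" "j * \<eta>' = \<eta>'" "\<xi>' * j = \<xi>'"
    by (simp_all add: defs dist)
  have sum: "\<xi> * \<eta> + \<xi>' * \<eta>' = i + j"
  proof -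
    have "\<xi> * \<eta> + \<xi>' * \<eta>' = (k *s i + (s * m) *s i) + (k *s j + (s * m) *s j)"
      by (simp add: defs dist ac_simps)
    then show ?thesis by (simp only: ki)
  qed
  have "\<eta> * t * \<xi> = (k * a + k * s * b + m * c + m * s * d) *s i"
    by (simp add: \<xi>_def \<eta>_def distrib_left distrib_right
        scale_right_distrib scale_mult ent[unfolded mult.assoc] scale_left_distrib mult_ac)
  then have "\<eta> * t * \<xi> = 0" using m by simp
  then have "\<xi> * \<eta> * t * (\<xi> * \<eta>) = 0" by (metis mult.assoc mult_zero_left mult_zero_right)
  moreover have "\<xi> * \<eta> * (\<xi>' * \<eta>') = 0" "\<xi>' * \<eta>' * (\<xi> * \<eta>) = 0"
    using prods by (metis mult.assoc mult_zero_left mult_zero_right)+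
  ultimately show ?thesis
    using that[OF min_idem_transfer[OF i prods(1) sides(1,2)] min_idem_transfer[OF j prods(2) sides(3,4)]] sum
    by blast
qed

text \<open>Induction on the number of members with nonzero diagonal entry. A move on i and j leaves
  the other members alone and makes one of the two new entries zero. The trace condition ranges over
  all families with sum e because the family changes during the induction.\<close>

lemma zero_diagonal_family:
  assumes "semisimple"
    and trace: "\<And>F f. orth_family F \<Longrightarrow> \<Sum>F = e \<Longrightarrow> f \<in> F \<Longrightarrow> (\<Sum>g | g \<in> F \<and> linked f g. corner_coeff g t) = 0"
    and "orth_family F" "\<Sum>F = e"
  shows "\<exists>G. orth_family G \<and> \<Sum>G = e \<and> (\<forall>g\<in>G. g * t * g = 0)"
  using assms(3,4)
proof (induction "card {f \<in> F. f * t * f \<noteq> 0}" arbitrary: F rule: less_induct)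
  case less
  note F = less.prems
  have fin: "finite F" and mi: "\<And>f. f \<in> F \<Longrightarrow> min_idem f" using F by (auto simp: orth_family_def)
  show ?case
  proof (cases "\<exists>i\<in>F. i * t * i \<noteq> 0")
    case True
    then obtain i where i: "i \<in> F" "i * t * i \<noteq> 0" by blast
    \<comment> \<open>The partner j is sought among nonzero entries only, so that the move removes
      two nonzero entries and creates at most one. If all entries over K were equal, their sum would
      be \<open>card K\<close> times a nonzero number, contrary to trace zero.\<close>
    define K where "K = {g \<in> F. linked i g \<and> corner_coeff g t \<noteq> 0}"
    have ti: "corner_coeff i t \<noteq> 0" using i by (simp add: corner_coeff_eq_0_iff mi)
    have "i * i * i \<noteq> 0" using mi[OF i(1)] by (simp add: min_idem_def)
    then have iK: "i \<in> K" using i ti by (auto simp: K_def linked_def)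
    have "(\<Sum>g\<in>K. corner_coeff g t) = (\<Sum>g | g \<in> F \<and> linked i g. corner_coeff g t)"
      by (rule sum.mono_neutral_left) (use fin in \<open>auto simp: K_def\<close>)
    then have K0: "(\<Sum>g\<in>K. corner_coeff g t) = 0" using trace[OF F i(1)] by simp
    have "\<exists>j\<in>K. corner_coeff i t \<noteq> corner_coeff j t"
    proof (rule ccontr)
      assume "\<not> ?thesis"
      then have "(\<Sum>g\<in>K. corner_coeff g t) = (\<Sum>g\<in>K. corner_coeff i t)" by (intro sum.cong) auto
      moreover have "card K \<noteq> 0" using iK fin by (auto simp: K_def)
      ultimately show False using K0 ti by simp
    qed
    then obtain j where j: "j \<in> F" "linked i j" "corner_coeff j t \<noteq> 0" "corner_coeff i t \<noteq> corner_coeff j t"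
      by (auto simp: K_def)
    then have ne: "i \<noteq> j" by auto
    have ij: "i * j = 0" "j * i = 0" using F(1) i j ne by (auto simp: orth_family_def)
    obtain p q where pq: "min_idem p" "min_idem q" "p * q = 0" "q * p = 0" "p + q = i + j" "p * t * p = 0"
      using pair_zero_diagonal[OF assms(1) mi[OF i(1)] mi[OF j(1)] ij j(2,4)] .
    define F0 where "F0 = F - {i, j}"
    have F0: "orth_family F0" using orth_family_subset[OF F(1)] by (auto simp: F0_def)
    have sumF: "e = \<Sum>F0 + (i + j)"
    proof -
      have "F = insert i (insert j F0)" using i j by (auto simp: F0_def)
      then have "\<Sum>F = i + (j + \<Sum>F0)" using ne fin
        by (metis DiffE F0_def finite_Diff finite_insert insertCI insertE sum.insert)
      then show ?thesis using F(2) by (simp add: algebra_simps)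
    qed
    have F0ij: "\<Sum>F0 * (i + j) = 0" "(i + j) * \<Sum>F0 = 0"
      using orth_family_sum_mult[OF F(1), of F0] i j by (auto simp: F0_def distrib_left distrib_right)
    have pp: "p * p = p" "q * q = q" using pq by (auto simp: min_idem_def)
    have q: "(i + j) * q = q" "q * (i + j) = q" and p: "(i + j) * p = p" "p * (i + j) = p"
      unfolding pq(5)[symmetric] by (simp_all add: distrib_left distrib_right pq(3,4) pp)
    have q0: "\<Sum>F0 * q = 0" "q * \<Sum>F0 = 0" and p0: "\<Sum>F0 * p = 0" "p * \<Sum>F0 = 0"
      using F0ij p q by (metis mult.assoc mult_zero_left mult_zero_right)+
    note Q = orth_family_insert[OF F0 pq(2) q0]
    have fin0: "finite F0" using fin by (simp add: F0_def)
    have sQ: "\<Sum>(insert q F0) = q + \<Sum>F0" using Q(2) fin0 by simp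
    have "orth_family (insert p (insert q F0))" "p \<notin> insert q F0"
      by (rule orth_family_insert[OF Q(1) pq(1)]; simp add: sQ distrib_left distrib_right p0 pq)+
    note P = this
    have sP: "\<Sum>(insert p (insert q F0)) = e"
      using P(2) fin0 sQ sumF pq(5) by (simp add: add.assoc[symmetric])
    let ?N = "\<lambda>F. {f \<in> F. f * t * f \<noteq> 0}"
    \<comment> \<open>Both i and j leave the set, p does not enter it, and q may.\<close>
    have "?N (insert p (insert q F0)) \<subseteq> insert q (?N F - {i, j})"
      using pq(6) by (auto simp: F0_def)
    then have "card (?N (insert p (insert q F0))) \<le> card (insert q (?N F - {i, j}))"
      using fin by (intro card_mono) auto
    also have "\<dots> \<le> Suc (card (?N F - {i, j}))" using fin by (simp add: card_insert_if)
    also have "\<dots> < card (?N F)"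
    proof -
      have sub: "{i, j} \<subseteq> ?N F" using i j by (auto simp: corner_coeff_eq_0_iff mi)
      have "card (?N F - {i, j}) = card (?N F) - 2"
        using sub ne fin by (subst card_Diff_subset) auto
      moreover have "2 \<le> card (?N F)"
        using card_mono[OF _ sub] ne fin by auto
      ultimately show ?thesis by linarith
    qed
    finally show ?thesis using less.hyps[OF _ P(1) sP] by blast
  qed (use F in blast)
qed

text \<open>Commutation with the diagonal x multiplies the entry of y at f, g by l f - l g. Off the
  diagonal this factor can be divided out, and on the diagonal both sides vanish by
  \<open>diag\<close>.\<close>

lemma zero_diagonal_commutator:
  assumes "semisimple" and F: "orth_family F" and t: "\<Sum>F * t = t" "t * \<Sum>F = t"
    and diag: "\<And>f. f \<in> F \<Longrightarrow> f * t * f = 0"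
  obtains x y where "x \<in> socle" "y \<in> socle" "t = x * y - y * x"
proof -
  have fin: "finite F" and mi: "\<And>f. f \<in> F \<Longrightarrow> min_idem f" using F by (auto simp: orth_family_def)
  obtain n :: "'a \<Rightarrow> nat" where n: "inj_on n F"
    using finite_imp_inj_to_nat_seg[OF fin] by blast
  define l where "l f = (of_nat (n f) :: complex)" for f
  have l: "l f \<noteq> l g" if "f \<in> F" "g \<in> F" "f \<noteq> g" for f g
    using that n by (auto simp: l_def inj_on_def)
  define \<kappa> where "\<kappa> f g = (if f = g then 0 else 1 / (l f - l g))" for f g
  define x where "x = (\<Sum>f\<in>F. l f *s f)"
  define y where "y = (\<Sum>f\<in>F. \<Sum>g\<in>F. \<kappa> f g *s (f * t * g))"
  have soc: "f \<in> socle" if "f \<in> F" for f using min_idem_in_socle[OF assms(1) mi[OF that]] .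
  have sub: "subspace socle" unfolding socle_def by (rule subspace_span)
  have "x \<in> socle" unfolding x_def by (intro subspace_sum[OF sub] subspace_scale[OF sub] soc)
  moreover have "y \<in> socle" unfolding y_def
    by (intro subspace_sum[OF sub] subspace_scale[OF sub] socle_left_mult soc)
  moreover have "t = x * y - y * x"
  proof -
    have xf: "x * f = l f *s f" "f * x = l f *s f" if "f \<in> F" for f
    proof -
      have "x * f = (\<Sum>g\<in>F. if g = f then l f *s f else 0)"
        unfolding x_def sum_distrib_right scale_mult
        using that orth_family_mult[OF F _ that] by (intro sum.cong) auto
      then show "x * f = l f *s f" using fin that by simp
      have "f * x = (\<Sum>g\<in>F. if f = g then l f *s f else 0)"
        unfolding x_def sum_distrib_left scale_mult
        using that orth_family_mult[OF F that] by (intro sum.cong) auto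
      then show "f * x = l f *s f" using fin that by simp
    qed
    have "x * y = (\<Sum>f\<in>F. \<Sum>g\<in>F. (l f * \<kappa> f g) *s (f * t * g))"
      unfolding y_def sum_distrib_left
      by (intro sum.cong refl) (simp add: scale_mult mult.assoc[symmetric] xf mult.commute)
    moreover have "y * x = (\<Sum>f\<in>F. \<Sum>g\<in>F. (l g * \<kappa> f g) *s (f * t * g))"
      unfolding y_def sum_distrib_right
      by (intro sum.cong refl) (simp add: scale_mult mult.assoc xf mult.commute)
    ultimately have "x * y - y * x = (\<Sum>f\<in>F. \<Sum>g\<in>F. ((l f - l g) * \<kappa> f g) *s (f * t * g))"
      by (simp add: sum_subtractf[symmetric] scale_left_diff_distrib[symmetric] left_diff_distrib)
    also have "\<dots> = (\<Sum>f\<in>F. \<Sum>g\<in>F. f * t * g)"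
    proof (intro sum.cong refl)
      fix f g assume "f \<in> F" "g \<in> F"
      then show "((l f - l g) * \<kappa> f g) *s (f * t * g) = f * t * g"
        using l[of f g] diag[of f] by (cases "f = g") (auto simp: \<kappa>_def)
    qed
    also have "\<dots> = \<Sum>F * t * \<Sum>F"
      by (simp add: sum_distrib_right) (simp add: sum_distrib_left)
    also have "\<dots> = t" by (simp add: t)
    finally show ?thesis by simp
  qed
  ultimately show ?thesis using that by blast
qed

section \<open>Sums of commutators of socle elements\<close>

text \<open>One family is enlarged four times until its sum is a unit for x, y, z and w. Their
  combination t then has trace zero in all blocks, and the zero diagonal argument applies to
  it.\<close>

lemma socle_commutator_add:
  assumes "semisimple" and S: "x \<in> socle" "y \<in> socle" "z \<in> socle" "w \<in> socle"
  obtains p q where "p \<in> socle" "q \<in> socle" "(x * y - y * x) + (z * w - w * z) = p * q - q * p"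
proof -
  let ?U = "\<lambda>F a. \<Sum>F * a = a \<and> a * \<Sum>F = a"
  have keep: "?U G a" if "orth_family G" "F \<subseteq> G" "?U F a" for F G a
    using orth_family_subset_sum[OF that(1,2)] that(3) by (metis mult.assoc)
  have "orth_family {}" by (simp add: orth_family_def)
  then obtain F1 where F1: "orth_family F1" "?U F1 x"
    using socle_orth_family_unit[OF assms(1) S(1)] by blast
  obtain F2 where F2: "F1 \<subseteq> F2" "orth_family F2" "?U F2 y"
    using socle_orth_family_unit[OF assms(1) S(2) F1(1)] by blast
  obtain F3 where F3: "F2 \<subseteq> F3" "orth_family F3" "?U F3 z"
    using socle_orth_family_unit[OF assms(1) S(3) F2(2)] by blast
  obtain F where F: "F3 \<subseteq> F" "orth_family F" "?U F w"
    using socle_orth_family_unit[OF assms(1) S(4) F3(2)] by blast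
  have "F1 \<subseteq> F" "F2 \<subseteq> F" using F1 F2 F3 F by auto
  then have U: "?U F x" "?U F y" "?U F z" "?U F w"
    using keep[OF F(2)] F1(2) F2(3) F3(3) F(1,3) by blast+
  define t where "t = (x * y - y * x) + (z * w - w * z)"
  have t: "?U F t"
  proof
    have "\<Sum>F * (a * b) = a * b" if "?U F a" for a b using that by (metis mult.assoc)
    then show "\<Sum>F * t = t" unfolding t_def using U by (simp add: distrib_left right_diff_distrib)
    have "(a * b) * \<Sum>F = a * b" if "?U F b" for a b using that by (metis mult.assoc)
    then show "t * \<Sum>F = t" unfolding t_def using U by (simp add: distrib_right left_diff_distrib)
  qed
  \<comment> \<open>\<open>block_trace_commutator\<close> sees a family through its sum as a unit,
    so the trace condition passes from F to every G with the same sum.\<close>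
  have "(\<Sum>g | g \<in> G \<and> linked f g. corner_coeff g t) = 0" if G: "orth_family G" "\<Sum>G = \<Sum>F" "f \<in> G" for G f
  proof -
    have mi: "min_idem g" if "g \<in> G" for g using that G(1) by (auto simp: orth_family_def)
    have "(\<Sum>g | g \<in> G \<and> linked f g. corner_coeff g t) =
        (\<Sum>g | g \<in> G \<and> linked f g. corner_coeff g (x * y - y * x) + corner_coeff g (z * w - w * z))"
      unfolding t_def by (intro sum.cong refl corner_coeff_add mi) auto
    then show ?thesis
      using U by (simp add: sum.distrib block_trace_commutator[OF assms(1) G(1,3)] G(2))
  qed
  from zero_diagonal_family[OF assms(1) this F(2) refl]
  obtain G where G: "orth_family G" "\<Sum>G = \<Sum>F" "\<And>g. g \<in> G \<Longrightarrow> g * t * g = 0" by blast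
  have "\<Sum>G * t = t" "t * \<Sum>G = t" using t G(2) by auto
  from zero_diagonal_commutator[OF assms(1) G(1) this G(3)] show ?thesis
    using that unfolding t_def by metis
qed

end

theorem theorem4p9:
  fixes scale :: "complex \<Rightarrow> 'a::{banach, real_normed_algebra, monoid_mult} \<Rightarrow> 'a"
  assumes "complex_banach_algebra scale"
    and "complex_banach_algebra.semisimple scale"
  defines "S \<equiv> complex_banach_algebra.socle scale"
  defines "C \<equiv> {x * y - y * x | x y. x \<in> S \<and> y \<in> S}"
  shows "module.subspace scale C \<and> C \<subseteq> S"
proof -
  interpret complex_banach_algebra scale by fact
  have S: "subspace S" unfolding S_def socle_def by (rule subspace_span)
  have "subspace C"
  proof (rule subspaceI)
    show "0 \<in> C" unfolding C_def using subspace_0[OF S] by force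
    show "a + b \<in> C" if "a \<in> C" "b \<in> C" for a b
      using that socle_commutator_add[OF assms(2)] unfolding C_def S_def by clarsimp metis
    show "scale c a \<in> C" if a: "a \<in> C" for c a
    proof -
      obtain x y where "x \<in> S" "y \<in> S" "a = x * y - y * x" using a by (auto simp: C_def)
      then have "scale c a = scale c x * y - y * scale c x" "scale c x \<in> S"
        by (auto simp: scale_mult scale_right_diff_distrib subspace_scale[OF S])
      then show ?thesis using \<open>y \<in> S\<close> unfolding C_def by blast
    qed
  qed
  moreover have "C \<subseteq> S"
    unfolding C_def using subspace_diff[OF S] socle_left_mult S_def by blast
  ultimately show ?thesis by blast
qed

end
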